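(* Let $(h_k)_{k\ge 1}$ be an increasing infinite sequence of positive integers, let $J\in\mathbb{Z}_{\ge 1}$, and let $\gamma=[f_0;f_1,f_2,\ldots]$ be an infinite simple continued fraction with convergents $E_k/F_k$ satisfying $E_{J-2}F_{h_kJ-1}=F_{J-1}E_{h_kJ-2}$ for all $k\in\mathbb{Z}_{\ge 1}$. Let $M,N\ge -1$ be integers, not both equal to $-1$, and let $\alpha=[b_0;b_1,\ldots,b_M,f_0,f_1,\ldots]$ and $\beta=[d_0;d_1,\ldots,d_N,f_0,f_1,\ldots]$ be infinite simple continued fractions with convergents $A_m/B_m$ and $C_n/D_n$, respectively. Put $c_1:=(F_{J-1}D_{N-1}+E_{J-2}D_N)^2$, $c_2:=(F_{J-1}B_{M-1}+E_{J-2}B_M)^2$ and $$q_{h_k}:=F_{J-1}B_{M-1}D_{N+h_kJ-1}+E_{J-2}B_MD_{N+h_kJ}.$$ Then for all $k\in\mathbb{Z}_{\ge1}$ $$q_{h_k}\,\|q_{h_k}\alpha\|\,\|q_{h_k}\beta\|\le\frac{c_1c_2}{q_{h_k}},$$ and therefore $\alpha$ and $\beta$ satisfy the Littlewood conjecture, i.e. $\liminf_{q\to\infty}q\,\|q\alpha\|\,\|q\beta\|=0$.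
   Context: For real $x$, $\|x\|:=\min_{k\in\mathbb{Z}}|x-k|$ is the distance to the nearest integer; $q$ ranges over positive integers. A simple continued fraction $[b_0;b_1,b_2,\ldots]$ has $b_0\in\mathbb{Z}$ and $b_n\in\mathbb{Z}_{\ge1}$ for $n\ge1$; an irrational number is identified with its infinite simple continued fraction. Its convergents $A_n/B_n=[b_0;b_1,\ldots,b_n]$ are given by $A_n=b_nA_{n-1}+A_{n-2}$, $B_n=b_nB_{n-1}+B_{n-2}$ $(n\ge 0)$ with $A_{-1}=1$, $B_{-1}=0$, $A_{-2}=0$, $B_{-2}=1$. The same recurrences and initial conventions (at indices $-1,-2$) define $C_n,D_n$ from the partial quotients of $\beta$ and $E_k,F_k$ from those of $\gamma$. Conventions: $M=-1$ means $\alpha=\gamma$ and $N=-1$ means $\beta=\gamma$. Since $\alpha$ and $\beta$ are simple continued fractions, $f_0\ge1$ whenever $M\ge0$ or $N\ge0$. *)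

theory Defs
  imports Complex_Main "HOL-Library.Extended_Real" "HOL-Library.Liminf_Limsup"
begin

definition nint_dist :: "real \<Rightarrow> real"
  where "nint_dist x = (INF k::int. \<bar>x - of_int k\<bar>)"

text \<open>The infimum is attained, so it is the minimum over the integers.\<close>

lemma nint_dist_eq_round: "nint_dist x = \<bar>x - of_int (round x)\<bar>"
  unfolding nint_dist_def
proof (rule cInf_eq_minimum)
  show "\<bar>x - of_int (round x)\<bar> \<in> range (\<lambda>k::int. \<bar>x - of_int k\<bar>)"
    by blast
  show "\<bar>x - of_int (round x)\<bar> \<le> y" if "y \<in> range (\<lambda>k::int. \<bar>x - of_int k\<bar>)" for y
    using that round_diff_minimal[of x] by auto
qed

definition simple_cf :: "(nat \<Rightarrow> int) \<Rightarrow> bool"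
  where "simple_cf b \<longleftrightarrow> (\<forall>n\<ge>1. b n \<ge> 1)"

fun cf_list :: "int list \<Rightarrow> real" where
  "cf_list [] = 0"
| "cf_list [a] = of_int a"
| "cf_list (a # as) = of_int a + 1 / cf_list as"

definition cf_convergent :: "(nat \<Rightarrow> int) \<Rightarrow> nat \<Rightarrow> real"
  where "cf_convergent b n = cf_list (map b [0..<Suc n])"

definition cf_value :: "(nat \<Rightarrow> int) \<Rightarrow> real"
  where "cf_value b = lim (cf_convergent b)"

text \<open>
  Numerators and denominators of the convergents are indexed by integers \<open>n \<ge> -2\<close>;
  the value 0 below index \<open>-2\<close> is a dummy.
\<close>

function cf_num :: "(nat \<Rightarrow> int) \<Rightarrow> int \<Rightarrow> int" where
  "cf_num b n =
     (if n \<ge> 0 then b (nat n) * cf_num b (n - 1) + cf_num b (n - 2)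
      else if n = -1 then 1 else 0)"
  by auto
termination by (relation "measure (\<lambda>(b, n). nat (n + 2))") auto

function cf_den :: "(nat \<Rightarrow> int) \<Rightarrow> int \<Rightarrow> int" where
  "cf_den b n =
     (if n \<ge> 0 then b (nat n) * cf_den b (n - 1) + cf_den b (n - 2)
      else if n = -2 then 1 else 0)"
  by auto
termination by (relation "measure (\<lambda>(b, n). nat (n + 2))") auto

declare cf_num.simps [simp del] cf_den.simps [simp del]

lemma cf_num_den_initial [simp]:
  "cf_num b (-2) = 0" "cf_num b (-1) = 1" "cf_den b (-2) = 1" "cf_den b (-1) = 0"
  by (subst cf_num.simps cf_den.simps, simp)+

lemma cf_num_den_0 [simp]: "cf_num b 0 = b 0" "cf_den b 0 = 1"
  by (subst cf_num.simps cf_den.simps, simp)+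

lemma cf_num_den_shift:
  "cf_num b (int n) = b 0 * cf_num (b \<circ> Suc) (int n - 1) + cf_den (b \<circ> Suc) (int n - 1)
   \<and> cf_den b (int n) = cf_num (b \<circ> Suc) (int n - 1)"
proof (induction n rule: less_induct)
  case (less n)
  consider "n = 0" | "n = 1" | m where "n = Suc (Suc m)"
    by (metis One_nat_def not0_implies_Suc)
  then show ?case
  proof cases
    case 1
    then show ?thesis
      by simp
  next
    case 2
    then show ?thesis
      by (simp add: cf_num.simps[of _ 1] cf_den.simps[of _ 1])
  next
    case 3
    have e: "int n - 1 = int (Suc m)" "int n - 2 = int m" "nat (int n) = Suc (Suc m)"
      "int (Suc m) - 1 = int m" "int (Suc m) - 2 = int m - 1" "nat (int (Suc m)) = Suc m"
      using 3 by auto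
    have "cf_num b (int n) = b (Suc (Suc m)) * cf_num b (int (Suc m)) + cf_num b (int m)"
      "cf_den b (int n) = b (Suc (Suc m)) * cf_den b (int (Suc m)) + cf_den b (int m)"
      unfolding cf_num.simps[of b "int n"] cf_den.simps[of b "int n"] e by simp_all
    moreover have
      "cf_num (b \<circ> Suc) (int (Suc m))
        = b (Suc (Suc m)) * cf_num (b \<circ> Suc) (int m) + cf_num (b \<circ> Suc) (int m - 1)"
      "cf_den (b \<circ> Suc) (int (Suc m))
        = b (Suc (Suc m)) * cf_den (b \<circ> Suc) (int m) + cf_den (b \<circ> Suc) (int m - 1)"
      unfolding cf_num.simps[of "b \<circ> Suc" "int (Suc m)"]
        cf_den.simps[of "b \<circ> Suc" "int (Suc m)"] e by simp_all
    moreover note less.IH[of m] less.IH[of "Suc m"]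
    ultimately show ?thesis
      using 3 unfolding e by (simp add: e comp_def algebra_simps)
  qed
qed

lemma cf_num_pos: "\<forall>n. b n \<ge> 1 \<Longrightarrow> cf_num b (int n) \<ge> 1 \<and> cf_num b (int n - 1) \<ge> 1"
proof (induction n)
  case 0
  then show ?case
    by simp
next
  case (Suc n)
  have "cf_num b (int (Suc n)) = b (Suc n) * cf_num b (int n) + cf_num b (int n - 1)"
    by (subst cf_num.simps) (simp add: nat_add_distrib)
  moreover have "b (Suc n) * cf_num b (int n) \<ge> 0"
    using Suc by (meson mult_nonneg_nonneg order_trans zero_le_one)
  ultimately show ?case
    using Suc by simp
qed

text \<open>The recurrences compute the finite continued fractions.\<close>

lemma cf_convergent_eq:
  assumes "simple_cf b"
  shows "cf_convergent b n = of_int (cf_num b (int n)) / of_int (cf_den b (int n))"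
  using assms
proof (induction n arbitrary: b)
  case 0
  then show ?case
    by (simp add: cf_convergent_def)
next
  case (Suc n)
  let ?b = "b \<circ> Suc"
  have pos: "\<forall>n. ?b n \<ge> 1"
    using Suc.prems by (simp add: simple_cf_def)
  then have "simple_cf ?b"
    by (simp add: simple_cf_def)
  from Suc.IH[OF this]
  have IH: "cf_convergent ?b n = of_int (cf_num ?b (int n)) / of_int (cf_den ?b (int n))" .
  have "map b [0..<Suc (Suc n)] = b 0 # map ?b [0..<Suc n]"
    by (simp add: upt_conv_Cons map_Suc_upt[symmetric] del: upt_Suc)
  moreover have "map ?b [0..<Suc n] = ?b 0 # map ?b [1..<Suc n]"
    by (simp add: upt_conv_Cons del: upt_Suc)
  ultimately have "cf_convergent b (Suc n) = of_int (b 0) + 1 / cf_convergent ?b n"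
    unfolding cf_convergent_def by (metis cf_list.simps(3))
  moreover have "cf_num ?b (int n) \<ge> 1"
    using cf_num_pos[OF pos] by blast
  ultimately show ?case
    using cf_num_den_shift[of b "Suc n"] unfolding IH by (simp add: field_simps)
qed

definition littlewood :: "real \<Rightarrow> real \<Rightarrow> bool"
  where "littlewood \<alpha> \<beta> \<longleftrightarrow>
    liminf (\<lambda>q::nat. ereal (real q * nint_dist (real q * \<alpha>) * nint_dist (real q * \<beta>))) = 0"

end

theory Submission
  imports Defs
begin

text \<open>
  Because \<open>\<alpha>\<close> and \<open>\<beta>\<close> share the tail \<open>\<gamma>\<close>, their denominators are \<open>B\<^sub>M\<^sub>+\<^sub>i = B\<^sub>M E\<^sub>i\<^sub>-\<^sub>1 + B\<^sub>M\<^sub>-\<^sub>1 F\<^sub>i\<^sub>-\<^sub>1\<close>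
  and \<open>D\<^sub>N\<^sub>+\<^sub>i = D\<^sub>N E\<^sub>i\<^sub>-\<^sub>1 + D\<^sub>N\<^sub>-\<^sub>1 F\<^sub>i\<^sub>-\<^sub>1\<close>. Hence the hypothesis on \<open>\<gamma>\<close> implies
  that \<open>q\<close>, a combination of two consecutive denominators of \<open>\<beta>\<close>, is also the combination of two
  consecutive denominators of \<open>\<alpha>\<close> obtained by exchanging the roles of \<open>\<alpha>\<close> and \<open>\<beta>\<close>. A number
  \<open>q = x D\<^sub>m\<^sub>-\<^sub>1 + y D\<^sub>m\<close> with \<open>x, y \<ge> 0\<close> satisfies \<open>q \<le> (x + y) D\<^sub>m\<close> and
  \<open>\<parallel>q\<beta>\<parallel> \<le> (x + y) / D\<^sub>m\<close>, so \<open>q \<parallel>q\<beta>\<parallel> \<le> (x + y)\<^sup>2\<close>, and likewise for \<open>\<alpha>\<close>.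
\<close>

section \<open>Recurrences and growth of the denominators\<close>

lemma cf_num_rec: "cf_num b (int n) = b n * cf_num b (int n - 1) + cf_num b (int n - 2)"
  by (subst cf_num.simps) simp

lemma cf_den_rec: "cf_den b (int n) = b n * cf_den b (int n - 1) + cf_den b (int n - 2)"
  by (subst cf_den.simps) simp

lemma cf_num_Suc: "cf_num b (int (Suc n)) = b (Suc n) * cf_num b (int n) + cf_num b (int n - 1)"
  using cf_num_rec[of b "Suc n"] by simp

lemma cf_den_Suc: "cf_den b (int (Suc n)) = b (Suc n) * cf_den b (int n) + cf_den b (int n - 1)"
  using cf_den_rec[of b "Suc n"] by simp

lemma cf_den_bounds:
  assumes "simple_cf b"
  shows "cf_den b (int n) \<ge> 1 \<and> cf_den b (int n - 1) \<ge> 0 \<and> cf_den b (int n - 1) \<le> cf_den b (int n)"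
proof (induction n)
  case 0
  then show ?case by simp
next
  case (Suc n)
  have "1 * cf_den b (int n) \<le> b (Suc n) * cf_den b (int n)"
    using Suc assms by (intro mult_right_mono) (auto simp: simple_cf_def)
  then have "cf_den b (int n) \<le> cf_den b (int (Suc n))"
    using Suc cf_den_Suc[of b n] by linarith
  then show ?case
    using Suc by simp
qed

lemma cf_den_ge_1: "simple_cf b \<Longrightarrow> cf_den b (int n) \<ge> 1"
  using cf_den_bounds by blast

lemma cf_den_nonneg: "simple_cf b \<Longrightarrow> n \<ge> -2 \<Longrightarrow> cf_den b n \<ge> 0"
proof -
  assume b: "simple_cf b" and n: "n \<ge> -2"
  show ?thesis
  proof (cases "n = -2")
    case False
    then obtain m where "n + 1 = int m"
      using n nonneg_int_cases[of "n + 1"] by auto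
    then have "n = int m - 1" by simp
    then show ?thesis
      using cf_den_bounds[OF b, of m] by simp
  qed simp
qed

lemma cf_den_ge_index: "simple_cf b \<Longrightarrow> cf_den b (int n) \<ge> int n"
proof (induction n)
  case 0
  then show ?case by simp
next
  case (Suc n)
  have den: "cf_den b (int n) \<le> b (Suc n) * cf_den b (int n)"
    using mult_right_mono[of 1 "b (Suc n)" "cf_den b (int n)"] Suc.prems cf_den_ge_1[of b n]
    by (simp add: simple_cf_def)
  show ?case
  \<comment> \<open>For \<open>n = 0\<close> the lower term of the recurrence is
    \<open>cf_den b (-1) = 0\<close> and adds nothing; from then on it adds at least 1.\<close>
  proof (cases n)
    case 0
    then show ?thesis using cf_den_ge_1[OF Suc.prems, of 1] by simp
  next
    case (Suc m)
    have "cf_den b (int n - 1) \<ge> 1"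
      using cf_den_ge_1[OF Suc.prems, of m] Suc by simp
    then show ?thesis
      using den Suc.IH[OF Suc.prems] cf_den_Suc[of b n] by simp
  qed
qed

section \<open>Approximation by convergents\<close>

lemma cf_det: "\<bar>cf_num b (int (Suc n)) * cf_den b (int n) - cf_num b (int n) * cf_den b (int (Suc n))\<bar> = 1"
proof -
  have "cf_num b (int n) * cf_den b (int n - 1) - cf_num b (int n - 1) * cf_den b (int n) = (- 1) ^ Suc n"
  proof (induction n)
    case (Suc n)
    then show ?case
      unfolding cf_num_Suc cf_den_Suc by (simp add: algebra_simps)
  qed simp
  then have "cf_num b (int (Suc n)) * cf_den b (int n) - cf_num b (int n) * cf_den b (int (Suc n)) = (- 1) ^ n"
    unfolding cf_num_Suc cf_den_Suc by (simp add: algebra_simps)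
  then show ?thesis
    by (simp add: power_abs)
qed

text \<open>As functions of \<open>i\<close>, the cross determinant and
  \<open>cf_den b (int (n + i))\<close> obey the same recurrence with positive coefficients. The
  determinant starts with 0 and has absolute value 1 at \<open>i = 1\<close>, so the comparison
  propagates by the triangle inequality.\<close>

lemma cf_cross_bound:
  assumes b: "simple_cf b"
  shows "\<bar>cf_num b (int (n + i)) * cf_den b (int n) - cf_num b (int n) * cf_den b (int (n + i))\<bar>
           * cf_den b (int (Suc n)) \<le> cf_den b (int (n + i))"
proof (induction i rule: induct_nat_012)
  case 0
  then show ?case
    using cf_den_ge_1[OF b, of n] by simp
next
  case 1
  then show ?case
    using cf_det[of b n] by simp
next
  case (ge2 i)
  define x where "x j = cf_num b (int (n + j)) * cf_den b (int n) - cf_num b (int n) * cf_den b (int (n + j))" for j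
  define D where "D j = cf_den b (int (n + j))" for j
  define t where "t = b (n + Suc (Suc i))"
  have t: "t \<ge> 1" using b by (simp add: t_def simple_cf_def)
  have D: "D (Suc (Suc i)) = t * D (Suc i) + D i"
    using cf_den_Suc[of b "n + Suc i"] by (simp add: D_def t_def)
  have x: "x (Suc (Suc i)) = t * x (Suc i) + x i"
    using cf_num_Suc[of b "n + Suc i"] cf_den_Suc[of b "n + Suc i"]
    by (simp add: x_def t_def algebra_simps)
  have D1: "D 1 \<ge> 1" using cf_den_ge_1[OF b, of "Suc n"] by (simp add: D_def)
  have "\<bar>x (Suc (Suc i))\<bar> \<le> t * \<bar>x (Suc i)\<bar> + \<bar>x i\<bar>"
    unfolding x using abs_triangle_ineq[of "t * x (Suc i)" "x i"] t by (simp add: abs_mult)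
  then have "\<bar>x (Suc (Suc i))\<bar> * D 1 \<le> (t * \<bar>x (Suc i)\<bar> + \<bar>x i\<bar>) * D 1"
    using D1 by (intro mult_right_mono) auto
  also have "\<dots> = t * (\<bar>x (Suc i)\<bar> * D 1) + \<bar>x i\<bar> * D 1"
    by (simp add: algebra_simps)
  also have "\<dots> \<le> t * D (Suc i) + D i"
    using ge2 t by (intro add_mono mult_left_mono) (simp_all add: x_def D_def)
  finally show ?case
    unfolding D[symmetric] by (simp add: x_def D_def)
qed

text \<open>This is the cross bound divided by the denominator at \<open>m\<close>. The resulting
  bound does not depend on \<open>m\<close>, so it yields the Cauchy property and survives the
  passage to the limit.\<close>

lemma cf_convergent_dist:
  assumes b: "simple_cf b" and "n \<le> m"
  shows "\<bar>cf_den b (int n) * cf_convergent b m - cf_num b (int n)\<bar> \<le> 1 / cf_den b (int (Suc n))"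
proof -
  obtain i where m: "m = n + i" using \<open>n \<le> m\<close> le_Suc_ex by blast
  define x where "x = cf_num b (int m) * cf_den b (int n) - cf_num b (int n) * cf_den b (int m)"
  have pos: "cf_den b (int m) > 0" "cf_den b (int (Suc n)) > 0"
    using cf_den_ge_1[OF b, of m] cf_den_ge_1[OF b, of "Suc n"] by linarith+
  have "\<bar>x\<bar> * cf_den b (int (Suc n)) \<le> cf_den b (int m)"
    using cf_cross_bound[OF b, of n i] by (simp add: x_def m)
  then have le: "\<bar>real_of_int x\<bar> * cf_den b (int (Suc n)) \<le> cf_den b (int m)"
    by (metis of_int_abs of_int_le_iff of_int_mult)
  have "cf_den b (int n) * cf_convergent b m - cf_num b (int n) = x / cf_den b (int m)"
    using pos by (simp add: cf_convergent_eq[OF b] x_def field_simps)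
  then have "\<bar>cf_den b (int n) * cf_convergent b m - cf_num b (int n)\<bar> = \<bar>real_of_int x\<bar> / cf_den b (int m)"
    using pos by simp
  also have "\<dots> \<le> 1 / cf_den b (int (Suc n))"
    using le pos by (simp add: field_simps)
  finally show ?thesis .
qed

text \<open>As \<open>cf_value\<close> is defined through \<open>lim\<close>, it carries information
  only once convergence is known.\<close>

lemma cf_convergent_tendsto:
  assumes b: "simple_cf b"
  shows "cf_convergent b \<longlonglongrightarrow> cf_value b"
proof -
  have step: "\<bar>cf_convergent b m - cf_convergent b n\<bar> \<le> 1 / real (Suc n)" if "n \<le> m" for m n
  proof -
    have pos: "cf_den b (int n) \<ge> 1" "real_of_int (cf_den b (int (Suc n))) \<ge> real (Suc n)"
      using cf_den_ge_1[OF b, of n] cf_den_ge_index[OF b, of "Suc n"]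
      by (simp_all del: of_nat_Suc)
    have "cf_den b (int n) * cf_convergent b m - cf_num b (int n)
        = cf_den b (int n) * (cf_convergent b m - cf_convergent b n)"
      using pos by (simp add: cf_convergent_eq[OF b, of n] field_simps)
    moreover have "1 / real_of_int (cf_den b (int (Suc n))) \<le> 1 / real (Suc n)"
      using pos by (intro divide_left_mono) auto
    ultimately have "cf_den b (int n) * \<bar>cf_convergent b m - cf_convergent b n\<bar> \<le> 1 / real (Suc n)"
      using cf_convergent_dist[OF b that] pos by (simp add: abs_mult)
    moreover have "1 * \<bar>cf_convergent b m - cf_convergent b n\<bar>
        \<le> cf_den b (int n) * \<bar>cf_convergent b m - cf_convergent b n\<bar>"
      using pos by (intro mult_right_mono) auto
    ultimately show ?thesis by (metis mult_1 order_trans)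
  qed
  have "Cauchy (cf_convergent b)"
  proof (rule metric_CauchyI)
    fix e :: real assume "e > 0"
    then obtain n where n: "1 / real (Suc n) < e / 2"
      using nat_approx_posE[of "e / 2"] by auto
    have "dist (cf_convergent b k) (cf_convergent b l) < e" if "k \<ge> n" "l \<ge> n" for k l
      using step[OF that(1)] step[OF that(2)] n unfolding dist_real_def by linarith
    then show "\<exists>n. \<forall>k\<ge>n. \<forall>l\<ge>n. dist (cf_convergent b k) (cf_convergent b l) < e"
      by blast
  qed
  then show ?thesis
    unfolding cf_value_def using Cauchy_convergent_iff convergent_LIMSEQ_iff by blast
qed

lemma cf_value_dist:
  assumes b: "simple_cf b"
  shows "\<bar>cf_den b (int n) * cf_value b - cf_num b (int n)\<bar> \<le> 1 / cf_den b (int (Suc n))"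
proof (rule LIMSEQ_le_const2)
  show "(\<lambda>m. \<bar>cf_den b (int n) * cf_convergent b m - cf_num b (int n)\<bar>)
      \<longlonglongrightarrow> \<bar>cf_den b (int n) * cf_value b - cf_num b (int n)\<bar>"
    by (intro tendsto_intros cf_convergent_tendsto[OF b])
  show "\<exists>k. \<forall>m\<ge>k. \<bar>cf_den b (int n) * cf_convergent b m - cf_num b (int n)\<bar> \<le> 1 / cf_den b (int (Suc n))"
    using cf_convergent_dist[OF b] by blast
qed

section \<open>Continued fractions with a common tail\<close>

text \<open>Both sides satisfy the recurrence in \<open>i\<close> whose coefficients are the partial
  quotients of \<open>f\<close>, and they agree at \<open>i = 0\<close> and
  \<open>i = 1\<close>.\<close>

lemma cf_den_shared_tail:
  assumes M: "M \<ge> -1" and tail: "\<forall>i. b (nat (M + 1) + i) = f i"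
  shows "cf_den b (M + int i) = cf_den b M * cf_num f (int i - 1) + cf_den b (M - 1) * cf_den f (int i - 1)"
proof (induction i rule: induct_nat_012)
  case 0
  then show ?case by simp
next
  case 1
  have "cf_den b (M + 1) = b (nat (M + 1)) * cf_den b M + cf_den b (M - 1)"
    using cf_den_rec[of b "nat (M + 1)"] M by simp
  then show ?case
    using tail[rule_format, of 0] by simp
next
  case (ge2 i)
  have e: "int (nat (M + 1) + Suc i) = M + int (Suc (Suc i))"
      "M + int (Suc (Suc i)) - 1 = M + int (Suc i)" "M + int (Suc (Suc i)) - 2 = M + int i"
    using M by simp_all
  have "cf_den b (M + int (Suc (Suc i))) = f (Suc i) * cf_den b (M + int (Suc i)) + cf_den b (M + int i)"
    using cf_den_rec[of b "nat (M + 1) + Suc i"] unfolding e tail[rule_format] .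
  also have "\<dots> = cf_den b M * (f (Suc i) * cf_num f (int i) + cf_num f (int i - 1))
      + cf_den b (M - 1) * (f (Suc i) * cf_den f (int i) + cf_den f (int i - 1))"
    unfolding ge2 by (simp add: algebra_simps)
  finally show ?case
    unfolding cf_num_Suc[symmetric] cf_den_Suc[symmetric] by simp
qed

section \<open>Distance to the nearest integer and the Littlewood liminf\<close>

lemma nint_dist_le: "nint_dist x \<le> \<bar>x - of_int k\<bar>"
  unfolding nint_dist_eq_round by (rule round_diff_minimal)

lemma nint_dist_nonneg: "nint_dist x \<ge> 0"
  by (simp add: nint_dist_eq_round)

text \<open>The same combination of numerators is an integer close to \<open>q * cf_value d\<close>:
  each of the two errors is at most the reciprocal of the denominator at \<open>m\<close>.
  Multiplying by \<open>q\<close> cancels that denominator.\<close>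

lemma nint_dist_den_combination:
  assumes d: "simple_cf d" and xy: "x \<ge> 0" "y \<ge> 0"
    and q: "q = x * cf_den d (int m - 1) + y * cf_den d (int m)"
  shows "real_of_int q * nint_dist (real_of_int q * cf_value d) \<le> real_of_int ((x + y)\<^sup>2)"
proof -
  let ?D = "\<lambda>n. real_of_int (cf_den d n)" and ?C = "\<lambda>n. real_of_int (cf_num d n)"
  let ?v = "cf_value d"
  have D1: "?D (int m) \<ge> 1"
    using cf_den_ge_1[OF d] by simp
  have dist0: "\<bar>?D (int m) * ?v - ?C (int m)\<bar> \<le> 1 / ?D (int m)"
  proof -
    have "?D (int m) \<le> ?D (int (Suc m))"
      using cf_den_bounds[OF d, of "Suc m"] by simp
    then have "1 / ?D (int (Suc m)) \<le> 1 / ?D (int m)"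
      using D1 by (intro divide_left_mono) auto
    then show ?thesis
      using cf_value_dist[OF d, of m] by linarith
  qed
  have dist1: "\<bar>?D (int m - 1) * ?v - ?C (int m - 1)\<bar> \<le> 1 / ?D (int m)"
  \<comment> \<open>For \<open>m = 0\<close> the left side is \<open>\<bar>0 - 1\<bar>\<close>, and
    the denominator on the right is 1.\<close>
  proof (cases m)
    case (Suc n)
    then show ?thesis using cf_value_dist[OF d, of n] by simp
  qed simp
  have q_nonneg: "q \<ge> 0"
    unfolding q using cf_den_bounds[OF d, of m] xy by simp
  have q_le: "real_of_int q \<le> (x + y) * ?D (int m)"
  proof -
    have "q \<le> x * cf_den d (int m) + y * cf_den d (int m)"
      unfolding q using cf_den_bounds[OF d, of m] xy by (intro add_mono mult_left_mono) auto
    then have "q \<le> (x + y) * cf_den d (int m)"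
      by (simp add: algebra_simps)
    then show ?thesis
      by (metis of_int_le_iff of_int_mult)
  qed
  have "nint_dist (q * ?v) \<le> \<bar>q * ?v - of_int (x * cf_num d (int m - 1) + y * cf_num d (int m))\<bar>"
    by (rule nint_dist_le)
  also have "\<dots> = \<bar>x * (?D (int m - 1) * ?v - ?C (int m - 1)) + y * (?D (int m) * ?v - ?C (int m))\<bar>"
    unfolding q by (simp add: algebra_simps)
  also have "\<dots> \<le> x * \<bar>?D (int m - 1) * ?v - ?C (int m - 1)\<bar> + y * \<bar>?D (int m) * ?v - ?C (int m)\<bar>"
    using xy by (intro order_trans[OF abs_triangle_ineq]) (simp add: abs_mult)
  also have "\<dots> \<le> x * (1 / ?D (int m)) + y * (1 / ?D (int m))"
    using xy dist0 dist1 by (intro add_mono mult_left_mono) auto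
  also have "\<dots> = (x + y) / ?D (int m)"
    by (simp add: add_divide_distrib)
  finally have "nint_dist (q * ?v) \<le> (x + y) / ?D (int m)" .
  then have "real_of_int q * nint_dist (q * ?v) \<le> ((x + y) * ?D (int m)) * ((x + y) / ?D (int m))"
    using q_le q_nonneg nint_dist_nonneg D1 xy by (intro mult_mono) auto
  also have "\<dots> = real_of_int ((x + y)\<^sup>2)"
    using D1 by (simp add: power2_eq_square)
  finally show ?thesis .
qed

text \<open>The product is nonnegative and tends to 0 along \<open>q\<close>. Since \<open>q\<close>
  tends to infinity, a positive liminf would keep the product above some \<open>e > 0\<close> along
  \<open>q\<close> as well.\<close>

lemma littlewoodI:
  assumes q: "filterlim q at_top sequentially"
    and le: "\<And>k. real (q k) * nint_dist (real (q k) * \<alpha>) * nint_dist (real (q k) * \<beta>) \<le> c / real (q k)"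
  shows "littlewood \<alpha> \<beta>"
proof -
  define u where "u q = real q * nint_dist (real q * \<alpha>) * nint_dist (real q * \<beta>)" for q :: nat
  have u_nonneg: "u q \<ge> 0" for q
    by (simp add: u_def nint_dist_nonneg)
  have lim0: "(\<lambda>k. c / real (q k)) \<longlonglongrightarrow> 0"
    by (intro real_tendsto_divide_at_top[OF tendsto_const] filterlim_compose[OF filterlim_real_sequentially q])
  have lim: "(\<lambda>k. u (q k)) \<longlonglongrightarrow> 0"
  proof (rule tendsto_sandwich[OF _ _ tendsto_const lim0])
    show "\<forall>\<^sub>F k in sequentially. 0 \<le> u (q k)"
      using u_nonneg by (intro always_eventually) blast
    show "\<forall>\<^sub>F k in sequentially. u (q k) \<le> c / real (q k)"
      using le unfolding u_def by (intro always_eventually) blast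
  qed
  have "liminf (\<lambda>q. ereal (u q)) \<le> 0"
  proof (rule ccontr)
    assume "\<not> ?thesis"
    then have "0 < liminf (\<lambda>q. ereal (u q))" by simp
    then obtain e where e: "0 < ereal e" "ereal e < liminf (\<lambda>q. ereal (u q))"
      using ereal_dense2 by blast
    have "\<forall>\<^sub>F n in sequentially. ereal e < ereal (u n)"
      using e(2) by (rule less_LiminfD)
    then have "\<forall>\<^sub>F k in sequentially. ereal e < ereal (u (q k))"
      by (rule eventually_compose_filterlim[OF _ q])
    moreover have "\<forall>\<^sub>F k in sequentially. u (q k) < e"
      using order_tendstoD(2)[OF lim, of e] e(1) by simp
    ultimately have "\<forall>\<^sub>F k :: nat in sequentially. False"
      by eventually_elim simp
    then show False by simp
  qed
  moreover have "liminf (\<lambda>q. ereal (u q)) \<ge> 0"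
    using u_nonneg by (intro Liminf_bounded) simp
  ultimately show ?thesis
    unfolding littlewood_def u_def by (intro antisym)
qed

section \<open>Exchanging the roles of \<alpha> and \<beta>\<close>

theorem corollary8:
  fixes h :: "nat \<Rightarrow> int" and J M N :: int
    and f b d :: "nat \<Rightarrow> int"
    and \<alpha> \<beta> :: real
    and B D E F q :: "int \<Rightarrow> int"
    and c\<^sub>1 c\<^sub>2 :: int
  assumes h_pos: "\<forall>k\<ge>1. h k \<ge> 1"
    and h_incr: "strict_mono_on {1..} h"
    and J: "J \<ge> 1"
    and f: "simple_cf f"
    and E: "E = cf_num f" and F: "F = cf_den f"
    and EF: "\<forall>k\<ge>1. E (J - 2) * F (h k * J - 1) = F (J - 1) * E (h k * J - 2)"
    and MN: "M \<ge> -1" "N \<ge> -1" "\<not> (M = -1 \<and> N = -1)"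
    and b: "simple_cf b" "\<forall>i. b (nat (M + 1) + i) = f i"
    and d: "simple_cf d" "\<forall>i. d (nat (N + 1) + i) = f i"
    and \<alpha>: "\<alpha> = cf_value b" and \<beta>: "\<beta> = cf_value d"
    and B: "B = cf_den b" and D: "D = cf_den d"
    and c\<^sub>1: "c\<^sub>1 = (F (J - 1) * D (N - 1) + E (J - 2) * D N)\<^sup>2"
    and c\<^sub>2: "c\<^sub>2 = (F (J - 1) * B (M - 1) + E (J - 2) * B M)\<^sup>2"
    and q: "\<forall>k\<ge>1. q (h k) = F (J - 1) * B (M - 1) * D (N + h k * J - 1)
                         + E (J - 2) * B M * D (N + h k * J)"
  shows "(\<forall>k\<ge>1. real_of_int (q (h k)) * nint_dist (real_of_int (q (h k)) * \<alpha>)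
                    * nint_dist (real_of_int (q (h k)) * \<beta>)
                  \<le> real_of_int (c\<^sub>1 * c\<^sub>2) / real_of_int (q (h k)))
         \<and> littlewood \<alpha> \<beta>"
proof -
  have f_pos: "\<forall>n. f n \<ge> 1"
  proof
    fix n
    \<comment> \<open>\<open>simple_cf f\<close> says nothing about \<open>f 0\<close>; its
      positivity comes from its place at a positive index of \<open>b\<close> or
      \<open>d\<close>.\<close>
    have "nat (M + 1) + n \<ge> 1 \<or> nat (N + 1) + n \<ge> 1"
      using MN by linarith
    then show "f n \<ge> 1"
      using b d by (metis simple_cf_def)
  qed
  have E_pos: "E (J - 2) \<ge> 1"
    using cf_num_pos[OF f_pos, of "nat (J - 1)"] J by (simp add: E)
  have F_pos: "F (J - 1) \<ge> 1"
    using cf_den_ge_1[OF f, of "nat (J - 1)"] J by (simp add: F)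
  have B_nonneg: "B n \<ge> 0" and D_nonneg: "D n \<ge> 0" if "n \<ge> -2" for n
    using that b(1) d(1) by (simp_all add: B D cf_den_nonneg)
  \<comment> \<open>The lower bound \<open>int k - 2\<close> serves to make \<open>q (h k)\<close>
    tend to infinity.\<close>
  have main: "real_of_int (q (h k)) * nint_dist (real_of_int (q (h k)) * \<alpha>) \<le> c\<^sub>1
      \<and> real_of_int (q (h k)) * nint_dist (real_of_int (q (h k)) * \<beta>) \<le> c\<^sub>2
      \<and> q (h k) \<ge> 0 \<and> q (h k) \<ge> int k - 2" if k: "k \<ge> 1" for k
  proof -
    have hk: "h k \<ge> int k"
      using k
    proof (induction k rule: nat_induct_at_least)
      case base
      then show ?case using h_pos by simp
    next
      case (Suc k)
      then have "h k < h (Suc k)"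
        using h_incr by (auto simp: strict_mono_on_def)
      then show ?case using Suc by simp
    qed
    have hJ: "h k * J \<ge> int k"
      using hk J k mult_mono[of "int k" "h k" 1 J] by simp
    define i where "i = nat (h k * J - 1)"
    have i: "h k * J = int (Suc i)"
      using hJ k by (simp add: i_def)
    note tailB = cf_den_shared_tail[OF MN(1) b(2), folded B E F]
    note tailD = cf_den_shared_tail[OF MN(2) d(2), folded D E F]
    have EFi: "E (J - 2) * F (int i) = F (J - 1) * E (int i - 1)"
    proof -
      have "h k * J - 1 = int i" "h k * J - 2 = int i - 1"
        using i by simp_all
      then show ?thesis using EF k by metis
    qed
    have B0: "B (M + int i) = B M * E (int i - 1) + B (M - 1) * F (int i - 1)"
      and B1: "B (M + int (Suc i)) = B M * E (int i) + B (M - 1) * F (int i)"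
      and D0: "D (N + int i) = D N * E (int i - 1) + D (N - 1) * F (int i - 1)"
      and D1: "D (N + int (Suc i)) = D N * E (int i) + D (N - 1) * F (int i)"
      using tailB[of i] tailB[of "Suc i"] tailD[of i] tailD[of "Suc i"] by simp_all
    have q1: "q (h k) = F (J - 1) * B (M - 1) * D (N + int i) + E (J - 2) * B M * D (N + int (Suc i))"
      using q k by (simp add: i)
    have q2: "q (h k) = F (J - 1) * D (N - 1) * B (M + int i) + E (J - 2) * D N * B (M + int (Suc i))"
    proof -
      \<comment> \<open>After inserting the tail formulas, the difference of the two combinations
        factors, and the hypothesis on \<open>f\<close> annihilates the second factor.\<close>
      have "q (h k) - (F (J - 1) * D (N - 1) * B (M + int i) + E (J - 2) * D N * B (M + int (Suc i)))
        = (B (M - 1) * D N - B M * D (N - 1)) * (F (J - 1) * E (int i - 1) - E (J - 2) * F (int i))"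
        unfolding q1 B0 B1 D0 D1 by (simp add: algebra_simps)
      then show ?thesis using EFi by simp
    qed
    define m where "m = nat (M + int (Suc i))"
    define n where "n = nat (N + int (Suc i))"
    have m: "M + int (Suc i) = int m" "M + int i = int m - 1"
      and n: "N + int (Suc i) = int n" "N + int i = int n - 1"
      using MN by (simp_all add: m_def n_def)
    \<comment> \<open>In \<open>q2\<close> the coefficients of the denominators of \<alpha> are
      built from those of \<beta>; this is why \<open>c\<^sub>1\<close>, defined through
      \<open>D\<close>, controls \<alpha>.\<close>
    have "real_of_int (q (h k)) * nint_dist (real_of_int (q (h k)) * \<alpha>) \<le> c\<^sub>1"
      unfolding \<alpha> c\<^sub>1
      by (rule nint_dist_den_combination[OF b(1) _ _ q2[unfolded m B]])
        (use E_pos F_pos D_nonneg MN in auto)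
    moreover have "real_of_int (q (h k)) * nint_dist (real_of_int (q (h k)) * \<beta>) \<le> c\<^sub>2"
      unfolding \<beta> c\<^sub>2
      by (rule nint_dist_den_combination[OF d(1) _ _ q1[unfolded n D]])
        (use E_pos F_pos B_nonneg MN in auto)
    moreover have "q (h k) \<ge> 0 \<and> q (h k) \<ge> int k - 2"
    proof -
      have B_mono: "0 \<le> B (int m - 1)" "B (int m - 1) \<le> B (int m)"
        using cf_den_bounds[OF b(1), of m] by (simp_all add: B)
      \<comment> \<open>Here \<open>int m = M + h k * J\<close> is at least
        \<open>int k - 1\<close>, so the index \<open>int m - 1\<close> is at least
        \<open>int k - 2\<close>.\<close>
      have B_ge: "int k - 2 \<le> B (int m - 1)"
      proof (cases m)
        case 0
        then show ?thesis using m hJ i MN by (simp add: B)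
      next
        case (Suc m')
        then have "B (int m - 1) \<ge> int m'"
          using cf_den_ge_index[OF b(1), of m'] by (simp add: B)
        then show ?thesis using Suc m hJ i MN by linarith
      qed
      have D_nn: "D (N - 1) \<ge> 0" "D N \<ge> 0"
        using MN by (auto intro: D_nonneg)
      have D_sum: "D (N - 1) + D N \<ge> 1"
      proof (cases "N = -1")
        \<comment> \<open>For \<open>N = -1\<close> the sum is carried by the initial value
          \<open>D (-2) = 1\<close>.\<close>
        case True
        then show ?thesis by (simp add: D)
      next
        case False
        then show ?thesis
          using cf_den_ge_1[OF d(1), of "nat N"] MN D_nn by (simp add: D)
      qed
      have "1 * B (int m - 1) \<le> (D (N - 1) + D N) * B (int m - 1)"
        using D_sum B_mono by (intro mult_right_mono) auto
      also have "\<dots> = 1 * D (N - 1) * B (int m - 1) + 1 * D N * B (int m - 1)"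
        by (simp add: algebra_simps)
      also have "\<dots> \<le> q (h k)"
        unfolding q2 m using D_nn B_mono E_pos F_pos by (intro add_mono mult_mono) auto
      finally show ?thesis using B_mono B_ge by simp
    qed
    ultimately show ?thesis by blast
  qed
  have bound: "real_of_int (q (h k)) * nint_dist (real_of_int (q (h k)) * \<alpha>)
                    * nint_dist (real_of_int (q (h k)) * \<beta>)
                  \<le> real_of_int (c\<^sub>1 * c\<^sub>2) / real_of_int (q (h k))" if "k \<ge> 1" for k
  \<comment> \<open>At 0 both sides vanish by the convention for division by 0. Otherwise the
    product of the two bounds in \<open>main\<close> is divided by \<open>q (h k)\<close>.\<close>
  proof (cases "q (h k) = 0")
    case False
    define Q where "Q = real_of_int (q (h k))"
    have Q: "Q > 0" using False main[OF that] by (simp add: Q_def)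
    have "Q * nint_dist (Q * \<alpha>) * (Q * nint_dist (Q * \<beta>)) \<le> c\<^sub>1 * c\<^sub>2"
      unfolding of_int_mult
      using main[OF that] Q nint_dist_nonneg by (intro mult_mono) (auto simp: Q_def c\<^sub>1)
    then show ?thesis
      using Q unfolding Q_def[symmetric] by (simp add: field_simps)
  qed simp
  have "littlewood \<alpha> \<beta>"
  proof (rule littlewoodI)
    \<comment> \<open>The shift by two absorbs the loss in the bound
      \<open>int k - 2\<close>.\<close>
    have "k \<le> nat (q (h (Suc (Suc k))))" for k
      using main[of "Suc (Suc k)"] by linarith
    then show "filterlim (\<lambda>k. nat (q (h (Suc (Suc k))))) at_top sequentially"
      by (intro filterlim_at_top_mono[OF filterlim_ident]) simp
    show "real (nat (q (h (Suc (Suc k))))) * nint_dist (real (nat (q (h (Suc (Suc k))))) * \<alpha>)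
        * nint_dist (real (nat (q (h (Suc (Suc k))))) * \<beta>)
        \<le> real_of_int (c\<^sub>1 * c\<^sub>2) / real (nat (q (h (Suc (Suc k)))))" for k
      using bound[of "Suc (Suc k)"] main[of "Suc (Suc k)"] by simp
  qed
  with bound show ?thesis by blast
qed

end
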